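(* Let $X$ be a real Banach space. Then $\mathcal{F}(X)$ is isomorphic (as a Banach space) to the countable $\ell_1$-sum of copies of itself: $$\mathcal{F}(X)\simeq\left(\sum_{n=1}^\infty \mathcal{F}(X)\right)_{\ell_1}.$$
   Context: For a pointed metric space $(M,d,0)$ (a metric space with a distinguished point $0$), $Lip_0(M)$ is the Banach space of all real-valued Lipschitz functions $f$ on $M$ with $f(0)=0$, with norm $\|f\|_{Lip}=\sup_{x\ne y}\frac{|f(x)-f(y)|}{d(x,y)}$. The Lipschitz-free space $\mathcal{F}(M)$ is the norm closure in $Lip_0(M)^*$ of the linear span of the evaluation functionals $\delta_x: f\mapsto f(x)$, $x\in M$; it is a predual of $Lip_0(M)$. Different choices of base point give isometrically isomorphic spaces, so the base point need not be specified. A Banach space is regarded as a metric space with its norm distance. $\simeq$ denotes linear isomorphism of Banach spaces (bounded linear bijection with bounded inverse), and $(\sum_n Y_n)_{\ell_1}$ is the space of sequences $(y_n)$, $y_n\in Y_n$, with norm $\sum_n\|y_n\|<\infty$. *)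

theory Defs
  imports "HOL-Analysis.Analysis"
begin

section \<open>The space of Lipschitz functions vanishing at the base point\<close>

text \<open>
  A pointed metric space is a type of sort \<open>{metric_space, zero}\<close>; its base point is \<open>0\<close>.
  A Banach space (sort \<open>banach\<close>) is thereby pointed by its origin.
\<close>

typedef (overloaded) 'a lip0 =
  "{f :: 'a::{metric_space, zero} \<Rightarrow> real. f 0 = 0 \<and> (\<exists>C. C-lipschitz_on UNIV f)}"
  morphisms lip0_apply Lip0
  by (rule exI[of _ "\<lambda>_. 0"]) (auto intro: lipschitz_on_constant)

setup_lifting type_definition_lip0

text \<open>
  Here the supremum ranges over all pairs. The pairs on the diagonal contribute \<open>0 / 0 = 0\<close>;
  they leave the supremum unchanged, and keep the set nonempty if the space is a single point.
\<close>

definition lip_const :: "('a::metric_space \<Rightarrow> real) \<Rightarrow> real" where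
  "lip_const f = (SUP (x, y). \<bar>f x - f y\<bar> / dist x y)"

lemma lip_const_bdd_above:
  fixes f :: "'a::metric_space \<Rightarrow> real"
  assumes "C-lipschitz_on UNIV f"
  shows "bdd_above (range (\<lambda>(x, y). \<bar>f x - f y\<bar> / dist x y))"
proof (rule bdd_aboveI[of _ C], clarify)
  fix x y
  have "\<bar>f x - f y\<bar> \<le> C * dist x y"
    using assms by (auto simp: lipschitz_on_def dist_real_def)
  then show "\<bar>f x - f y\<bar> / dist x y \<le> C"
    using assms by (cases "x = y") (auto simp: divide_simps lipschitz_on_def)
qed

lemma lip_const_upper:
  fixes f :: "'a::metric_space \<Rightarrow> real"
  assumes "C-lipschitz_on UNIV f"
  shows "\<bar>f x - f y\<bar> \<le> lip_const f * dist x y"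
proof (cases "x = y")
  case False
  have "\<bar>f x - f y\<bar> / dist x y \<le> lip_const f"
    unfolding lip_const_def
    using cSUP_upper[OF _ lip_const_bdd_above[OF assms], of "(x, y)"] by simp
  with False show ?thesis by (simp add: divide_simps)
qed simp

lemma lip_const_nonneg:
  fixes f :: "'a::metric_space \<Rightarrow> real"
  assumes "C-lipschitz_on UNIV f"
  shows "0 \<le> lip_const f"
  using cSUP_upper[OF _ lip_const_bdd_above[OF assms], of "(undefined, undefined)"]
  by (simp add: lip_const_def)

lemma lip_const_least:
  fixes f :: "'a::metric_space \<Rightarrow> real"
  assumes "0 \<le> C" "\<And>x y. \<bar>f x - f y\<bar> \<le> C * dist x y"
  shows "lip_const f \<le> C"
  unfolding lip_const_def
proof (rule cSUP_least)
  fix z :: "'a \<times> 'a"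
  obtain x y where z: "z = (x, y)" by fastforce
  show "(case z of (x, y) \<Rightarrow> \<bar>f x - f y\<bar> / dist x y) \<le> C"
    using assms(1) assms(2)[of x y] by (cases "x = y") (auto simp: z divide_simps)
qed simp

lemma lip_const_add:
  fixes f g :: "'a::metric_space \<Rightarrow> real"
  assumes f: "C-lipschitz_on UNIV f" and g: "D-lipschitz_on UNIV g"
  shows "lip_const (\<lambda>x. f x + g x) \<le> lip_const f + lip_const g"
proof (rule lip_const_least)
  show "0 \<le> lip_const f + lip_const g"
    using lip_const_nonneg[OF f] lip_const_nonneg[OF g] by simp
next
  fix x y
  show "\<bar>f x + g x - (f y + g y)\<bar> \<le> (lip_const f + lip_const g) * dist x y"
    using lip_const_upper[OF f, of x y] lip_const_upper[OF g, of x y]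
    by (simp add: algebra_simps)
qed

lemma lip_const_scale:
  fixes f :: "'a::metric_space \<Rightarrow> real"
  assumes f: "C-lipschitz_on UNIV f"
  shows "lip_const (\<lambda>x. a * f x) = \<bar>a\<bar> * lip_const f"
proof -
  have le: "lip_const (\<lambda>x. b * g x) \<le> \<bar>b\<bar> * lip_const g"
    if g: "D-lipschitz_on UNIV g" for b D and g :: "'a \<Rightarrow> real"
  proof (rule lip_const_least)
    show "0 \<le> \<bar>b\<bar> * lip_const g"
      using lip_const_nonneg[OF g] by simp
  next
    fix x y
    have "\<bar>b * g x - b * g y\<bar> = \<bar>b\<bar> * \<bar>g x - g y\<bar>"
      by (simp add: abs_mult[symmetric] algebra_simps)
    also have "\<dots> \<le> \<bar>b\<bar> * (lip_const g * dist x y)"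
      by (intro mult_left_mono lip_const_upper[OF g]) simp
    finally show "\<bar>b * g x - b * g y\<bar> \<le> \<bar>b\<bar> * lip_const g * dist x y"
      by (simp add: mult.assoc)
  qed
  show ?thesis
  proof (cases "a = 0")
    case True
    then show ?thesis
      using lip_const_least[of 0 "\<lambda>_::'a. 0"]
        lip_const_nonneg[OF lipschitz_on_constant[of UNIV "0::real"], where ?'a = 'a]
      by simp
  next
    case False
    have "lip_const f = lip_const (\<lambda>x. inverse a * (a * f x))"
      using False by (simp add: mult.assoc[symmetric])
    also have "\<dots> \<le> \<bar>inverse a\<bar> * lip_const (\<lambda>x. a * f x)"
      by (rule le[OF lipschitz_on_cmult_real[OF f]])
    finally have "\<bar>a\<bar> * lip_const f \<le> lip_const (\<lambda>x. a * f x)"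
      using False by (simp add: field_simps)
    with le[OF f] show ?thesis by (intro order_antisym)
  qed
qed

instantiation lip0 :: ("{metric_space, zero}") real_normed_vector
begin

lift_definition norm_lip0 :: "'a lip0 \<Rightarrow> real" is lip_const .

lift_definition zero_lip0 :: "'a lip0" is "\<lambda>_. 0"
  by (auto intro: lipschitz_on_constant)

lift_definition plus_lip0 :: "'a lip0 \<Rightarrow> 'a lip0 \<Rightarrow> 'a lip0" is "\<lambda>f g x. f x + g x"
  by (auto intro: lipschitz_on_add)

lift_definition minus_lip0 :: "'a lip0 \<Rightarrow> 'a lip0 \<Rightarrow> 'a lip0" is "\<lambda>f g x. f x - g x"
  by (auto intro: lipschitz_on_diff)

lift_definition uminus_lip0 :: "'a lip0 \<Rightarrow> 'a lip0" is "\<lambda>f x. - f x"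
  by auto

lift_definition scaleR_lip0 :: "real \<Rightarrow> 'a lip0 \<Rightarrow> 'a lip0" is "\<lambda>a f x. a * f x"
  by (auto intro: lipschitz_on_cmult_real)

definition dist_lip0 :: "'a lip0 \<Rightarrow> 'a lip0 \<Rightarrow> real"
  where "dist_lip0 f g = norm (f - g)"

definition [code del]:
  "(uniformity :: ('a lip0 \<times> 'a lip0) filter) = (INF e\<in>{0 <..}. principal {(x, y). dist x y < e})"

definition open_lip0 :: "'a lip0 set \<Rightarrow> bool"
  where [code del]: "open_lip0 S = (\<forall>x\<in>S. \<forall>\<^sub>F (x', y) in uniformity. x' = x \<longrightarrow> y \<in> S)"

definition sgn_lip0 :: "'a lip0 \<Rightarrow> 'a lip0"
  where "sgn_lip0 f = inverse (norm f) *\<^sub>R f"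

instance
proof
  fix f g h :: "'a lip0" and a b :: real
  show "f + g + h = f + (g + h)" "f + g = g + f" "0 + f = f" "- f + f = 0" "f - g = f + - g"
    by (transfer; simp add: algebra_simps)+
  show "a *\<^sub>R (f + g) = a *\<^sub>R f + a *\<^sub>R g" "(a + b) *\<^sub>R f = a *\<^sub>R f + b *\<^sub>R f"
    "a *\<^sub>R b *\<^sub>R f = (a * b) *\<^sub>R f" "1 *\<^sub>R f = f"
    by (transfer; simp add: algebra_simps)+
  show "dist f g = norm (f - g)" by (rule dist_lip0_def)
  show "sgn f = inverse (norm f) *\<^sub>R f" by (rule sgn_lip0_def)
  show "uniformity = (INF e\<in>{0 <..}. principal {(x :: 'a lip0, y). dist x y < e})"
    by (rule uniformity_lip0_def)
  show "open U = (\<forall>x\<in>U. \<forall>\<^sub>F (x', y) in uniformity. x' = x \<longrightarrow> y \<in> U)" for U :: "'a lip0 set"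
    by (rule open_lip0_def)
  show "norm f = 0 \<longleftrightarrow> f = 0"
  proof transfer
    fix f :: "'a \<Rightarrow> real"
    assume f: "f 0 = 0 \<and> (\<exists>C. C-lipschitz_on UNIV f)"
    then obtain C where C: "C-lipschitz_on UNIV f" by blast
    show "lip_const f = 0 \<longleftrightarrow> f = (\<lambda>_. 0)"
    proof
      assume "lip_const f = 0"
      then show "f = (\<lambda>_. 0)"
        using lip_const_upper[OF C, of _ 0] f by auto
    next
      assume "f = (\<lambda>_. 0)"
      then show "lip_const f = 0"
        using lip_const_least[of 0 f] lip_const_nonneg[OF C] by simp
    qed
  qed
  show "norm (f + g) \<le> norm f + norm g"
    by transfer (auto intro: lip_const_add)
  show "norm (a *\<^sub>R f) = \<bar>a\<bar> * norm f"
    by transfer (auto intro: lip_const_scale)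
qed

end


section \<open>The Lipschitz-free space\<close>

lift_definition evaluation :: "'a::{metric_space, zero} \<Rightarrow> 'a lip0 \<Rightarrow>\<^sub>L real"
  is "\<lambda>x f. lip0_apply f x"
proof (rule bounded_linear_intro)
  fix x :: 'a and f g :: "'a lip0" and r :: real
  show "lip0_apply (f + g) x = lip0_apply f x + lip0_apply g x" by transfer simp
  show "lip0_apply (r *\<^sub>R f) x = r *\<^sub>R lip0_apply f x" by transfer simp
  show "norm (lip0_apply f x) \<le> norm f * dist x 0"
  proof transfer
    fix f :: "'a \<Rightarrow> real" and x :: 'a
    assume f: "f 0 = 0 \<and> (\<exists>C. C-lipschitz_on UNIV f)"
    then obtain C where "C-lipschitz_on UNIV f" by blast
    from lip_const_upper[OF this, of x 0] f show "norm (f x) \<le> lip_const f * dist x 0" by simp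
  qed
qed

typedef (overloaded) 'a lipschitz_free =
  "closure (span (range (evaluation :: 'a::{metric_space, zero} \<Rightarrow> 'a lip0 \<Rightarrow>\<^sub>L real)))"
  morphisms functional_of Lipschitz_free
  using closure_subset span_zero by blast

setup_lifting type_definition_lipschitz_free

lemma subspace_closure:
  fixes S :: "'b::real_normed_vector set"
  assumes S: "subspace S"
  shows "subspace (closure S)"
proof (rule subspaceI)
  show "0 \<in> closure S" using closure_subset subspace_0[OF S] by blast
next
  fix x y assume "x \<in> closure S" "y \<in> closure S"
  then obtain u v where u: "\<And>n. u n \<in> S" "u \<longlonglongrightarrow> x" and v: "\<And>n. v n \<in> S" "v \<longlonglongrightarrow> y"
    unfolding closure_sequential by metis
  have "(\<lambda>n. u n + v n) \<longlonglongrightarrow> x + y" using u v by (intro tendsto_add)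
  moreover have "u n + v n \<in> S" for n using u v subspace_add[OF S] by blast
  ultimately show "x + y \<in> closure S"
    unfolding closure_sequential by (intro exI[of _ "\<lambda>n. u n + v n"]) blast
next
  fix c :: real and x assume "x \<in> closure S"
  then obtain u where u: "\<And>n. u n \<in> S" "u \<longlonglongrightarrow> x"
    unfolding closure_sequential by metis
  have "(\<lambda>n. c *\<^sub>R u n) \<longlonglongrightarrow> c *\<^sub>R x" using u by (intro tendsto_intros)
  moreover have "c *\<^sub>R u n \<in> S" for n using u subspace_scale[OF S] by blast
  ultimately show "c *\<^sub>R x \<in> closure S"
    unfolding closure_sequential by (intro exI[of _ "\<lambda>n. c *\<^sub>R u n"]) blast
qed

lemmas subspace_free = subspace_closure[OF subspace_span]

instantiation lipschitz_free :: ("{metric_space, zero}") real_normed_vector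
begin

lift_definition norm_lipschitz_free :: "'a lipschitz_free \<Rightarrow> real" is norm .

lift_definition zero_lipschitz_free :: "'a lipschitz_free" is 0
  by (rule subspace_0[OF subspace_free])

lift_definition plus_lipschitz_free :: "'a lipschitz_free \<Rightarrow> 'a lipschitz_free \<Rightarrow> 'a lipschitz_free" is "(+)"
  by (rule subspace_add[OF subspace_free])

lift_definition minus_lipschitz_free :: "'a lipschitz_free \<Rightarrow> 'a lipschitz_free \<Rightarrow> 'a lipschitz_free" is "(-)"
  by (rule subspace_diff[OF subspace_free])

lift_definition uminus_lipschitz_free :: "'a lipschitz_free \<Rightarrow> 'a lipschitz_free" is uminus
  by (rule subspace_neg[OF subspace_free])

lift_definition scaleR_lipschitz_free :: "real \<Rightarrow> 'a lipschitz_free \<Rightarrow> 'a lipschitz_free" is scaleR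
  by (rule subspace_scale[OF subspace_free])

definition dist_lipschitz_free :: "'a lipschitz_free \<Rightarrow> 'a lipschitz_free \<Rightarrow> real"
  where "dist_lipschitz_free f g = norm (f - g)"

definition [code del]:
  "(uniformity :: ('a lipschitz_free \<times> 'a lipschitz_free) filter) =
    (INF e\<in>{0 <..}. principal {(x, y). dist x y < e})"

definition open_lipschitz_free :: "'a lipschitz_free set \<Rightarrow> bool"
  where [code del]: "open_lipschitz_free S = (\<forall>x\<in>S. \<forall>\<^sub>F (x', y) in uniformity. x' = x \<longrightarrow> y \<in> S)"

definition sgn_lipschitz_free :: "'a lipschitz_free \<Rightarrow> 'a lipschitz_free"
  where "sgn_lipschitz_free f = inverse (norm f) *\<^sub>R f"

instance
proof
  fix f g h :: "'a lipschitz_free" and a b :: real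
  show "f + g + h = f + (g + h)" "f + g = g + f" "0 + f = f" "- f + f = 0" "f - g = f + - g"
    by (transfer; simp add: algebra_simps)+
  show "a *\<^sub>R (f + g) = a *\<^sub>R f + a *\<^sub>R g" "(a + b) *\<^sub>R f = a *\<^sub>R f + b *\<^sub>R f"
    "a *\<^sub>R b *\<^sub>R f = (a * b) *\<^sub>R f" "1 *\<^sub>R f = f"
    by (transfer; simp add: algebra_simps)+
  show "dist f g = norm (f - g)" by (rule dist_lipschitz_free_def)
  show "sgn f = inverse (norm f) *\<^sub>R f" by (rule sgn_lipschitz_free_def)
  show "uniformity = (INF e\<in>{0 <..}. principal {(x :: 'a lipschitz_free, y). dist x y < e})"
    by (rule uniformity_lipschitz_free_def)
  show "open U = (\<forall>x\<in>U. \<forall>\<^sub>F (x', y) in uniformity. x' = x \<longrightarrow> y \<in> U)"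
    for U :: "'a lipschitz_free set"
    by (rule open_lipschitz_free_def)
  show "norm f = 0 \<longleftrightarrow> f = 0" by transfer simp
  show "norm (f + g) \<le> norm f + norm g" by transfer (rule norm_triangle_ineq)
  show "norm (a *\<^sub>R f) = \<bar>a\<bar> * norm f" by transfer simp
qed

end

lemma dist_functional_of: "dist (functional_of u) (functional_of v) = dist u v"
  unfolding dist_norm by transfer simp

instance lipschitz_free :: ("{metric_space, zero}") banach
proof
  fix X :: "nat \<Rightarrow> 'a lipschitz_free"
  assume "Cauchy X"
  then have "Cauchy (\<lambda>n. functional_of (X n))"
    by (simp add: Cauchy_def dist_functional_of)
  then obtain L where L: "(\<lambda>n. functional_of (X n)) \<longlonglongrightarrow> L"
    using Cauchy_convergent_iff convergent_def by blast
  have "L \<in> closure (span (range evaluation))"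
    by (rule closed_sequentially[OF closed_closure _ L]) (rule functional_of)
  then obtain l where "functional_of l = L" by (metis Lipschitz_free_inverse)
  with L have "X \<longlonglongrightarrow> l"
    by (auto simp: lim_sequentially dist_functional_of[symmetric])
  then show "convergent X" by (auto simp: convergent_def)
qed


section \<open>The countable sum of copies of a normed space in the sense of \<open>\<ell>\<^sub>1\<close>\<close>

typedef (overloaded) 'b l1_sum = "{y :: nat \<Rightarrow> 'b::real_normed_vector. summable (\<lambda>n. norm (y n))}"
  morphisms l1_nth L1_sum
  by (rule exI[of _ "\<lambda>_. 0"]) simp

setup_lifting type_definition_l1_sum

lemma summable_norm_add:
  fixes y z :: "nat \<Rightarrow> 'b::real_normed_vector"
  assumes "summable (\<lambda>n. norm (y n))" "summable (\<lambda>n. norm (z n))"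
  shows "summable (\<lambda>n. norm (y n + z n))"
  by (rule summable_comparison_test'[OF summable_add[OF assms], of 0]) (simp add: norm_triangle_ineq)

instantiation l1_sum :: (real_normed_vector) real_normed_vector
begin

lift_definition norm_l1_sum :: "'a l1_sum \<Rightarrow> real" is "\<lambda>y. \<Sum>n. norm (y n)" .

lift_definition zero_l1_sum :: "'a l1_sum" is "\<lambda>_. 0" by simp

lift_definition plus_l1_sum :: "'a l1_sum \<Rightarrow> 'a l1_sum \<Rightarrow> 'a l1_sum" is "\<lambda>y z n. y n + z n"
  by (rule summable_norm_add)

lift_definition minus_l1_sum :: "'a l1_sum \<Rightarrow> 'a l1_sum \<Rightarrow> 'a l1_sum" is "\<lambda>y z n. y n - z n"
  subgoal for y z using summable_norm_add[of y "\<lambda>n. - z n"] by simp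
  done

lift_definition uminus_l1_sum :: "'a l1_sum \<Rightarrow> 'a l1_sum" is "\<lambda>y n. - y n" by simp

lift_definition scaleR_l1_sum :: "real \<Rightarrow> 'a l1_sum \<Rightarrow> 'a l1_sum" is "\<lambda>a y n. a *\<^sub>R y n"
  by (simp add: summable_mult)

definition dist_l1_sum :: "'a l1_sum \<Rightarrow> 'a l1_sum \<Rightarrow> real"
  where "dist_l1_sum y z = norm (y - z)"

definition [code del]:
  "(uniformity :: ('a l1_sum \<times> 'a l1_sum) filter) = (INF e\<in>{0 <..}. principal {(x, y). dist x y < e})"

definition open_l1_sum :: "'a l1_sum set \<Rightarrow> bool"
  where [code del]: "open_l1_sum S = (\<forall>x\<in>S. \<forall>\<^sub>F (x', y) in uniformity. x' = x \<longrightarrow> y \<in> S)"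

definition sgn_l1_sum :: "'a l1_sum \<Rightarrow> 'a l1_sum"
  where "sgn_l1_sum y = inverse (norm y) *\<^sub>R y"

instance
proof
  fix f g h :: "'a l1_sum" and a b :: real
  show "f + g + h = f + (g + h)" "f + g = g + f" "0 + f = f" "- f + f = 0" "f - g = f + - g"
    by (transfer; simp add: algebra_simps)+
  show "a *\<^sub>R (f + g) = a *\<^sub>R f + a *\<^sub>R g" "(a + b) *\<^sub>R f = a *\<^sub>R f + b *\<^sub>R f"
    "a *\<^sub>R b *\<^sub>R f = (a * b) *\<^sub>R f" "1 *\<^sub>R f = f"
    by (transfer; simp add: algebra_simps)+
  show "dist f g = norm (f - g)" by (rule dist_l1_sum_def)
  show "sgn f = inverse (norm f) *\<^sub>R f" by (rule sgn_l1_sum_def)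
  show "uniformity = (INF e\<in>{0 <..}. principal {(x :: 'a l1_sum, y). dist x y < e})"
    by (rule uniformity_l1_sum_def)
  show "open U = (\<forall>x\<in>U. \<forall>\<^sub>F (x', y) in uniformity. x' = x \<longrightarrow> y \<in> U)" for U :: "'a l1_sum set"
    by (rule open_l1_sum_def)
  show "norm f = 0 \<longleftrightarrow> f = 0"
    by transfer (auto simp: suminf_eq_zero_iff fun_eq_iff)
  show "norm (f + g) \<le> norm f + norm g"
  proof transfer
    fix f g :: "nat \<Rightarrow> 'a"
    assume *: "summable (\<lambda>n. norm (f n))" "summable (\<lambda>n. norm (g n))"
    have "(\<Sum>n. norm (f n + g n)) \<le> (\<Sum>n. norm (f n) + norm (g n))"
      by (intro suminf_le norm_triangle_ineq summable_norm_add summable_add *)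
    then show "(\<Sum>n. norm (f n + g n)) \<le> (\<Sum>n. norm (f n)) + (\<Sum>n. norm (g n))"
      by (simp add: suminf_add *)
  qed
  show "norm (a *\<^sub>R f) = \<bar>a\<bar> * norm f"
    by transfer (simp add: suminf_mult)
qed

end

instance l1_sum :: (banach) banach
proof
  fix X :: "nat \<Rightarrow> 'a l1_sum"
  assume X: "Cauchy X"
  have summ: "summable (\<lambda>n. norm (l1_nth y n))" for y :: "'a l1_sum"
    using l1_nth[of y] by simp
  have part: "(\<Sum>n<N. norm (l1_nth y n)) \<le> norm y" for y :: "'a l1_sum" and N
    unfolding norm_l1_sum.rep_eq by (intro sum_le_suminf summ) auto
  have coord: "norm (l1_nth y n) \<le> norm y" for y :: "'a l1_sum" and n
    using part[where N = "Suc n" and y = y] sum_nonneg[of "{..<n}" "\<lambda>n. norm (l1_nth y n)"] by simp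
  have diff: "l1_nth (y - z) n = l1_nth y n - l1_nth z n" for y z :: "'a l1_sum" and n
    by transfer simp
  have "Cauchy (\<lambda>m. l1_nth (X m) n)" for n
  proof (rule CauchyI)
    fix e :: real assume "0 < e"
    with X obtain M where M: "\<And>k m. M \<le> k \<Longrightarrow> M \<le> m \<Longrightarrow> norm (X k - X m) < e"
      by (meson CauchyD)
    show "\<exists>M. \<forall>k\<ge>M. \<forall>m\<ge>M. norm (l1_nth (X k) n - l1_nth (X m) n) < e"
      using M coord[where y = "X _ - X _" and n = n] unfolding diff by (meson le_less_trans)
  qed
  then have "\<forall>n. \<exists>l. (\<lambda>m. l1_nth (X m) n) \<longlonglongrightarrow> l"
    using Cauchy_convergent_iff convergent_def by blast
  then obtain l where l: "\<And>n. (\<lambda>m. l1_nth (X m) n) \<longlonglongrightarrow> l n" by metis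
  have bound: "(\<Sum>n<N. norm (l1_nth (X k) n - l n)) \<le> e"
    if "\<And>m. M \<le> m \<Longrightarrow> norm (X k - X m) < e" for k M N e
  proof (rule LIMSEQ_le_const2)
    show "(\<lambda>m. \<Sum>n<N. norm (l1_nth (X k) n - l1_nth (X m) n)) \<longlonglongrightarrow>
      (\<Sum>n<N. norm (l1_nth (X k) n - l n))"
      by (intro tendsto_intros l)
    show "\<exists>M. \<forall>m\<ge>M. (\<Sum>n<N. norm (l1_nth (X k) n - l1_nth (X m) n)) \<le> e"
      using that part[where N = N and y = "X k - X _"] unfolding diff by (meson less_imp_le order_trans)
  qed
  have sumbd: "summable (\<lambda>n. norm (l1_nth (X k) n - l n))"
    if "\<And>m. M \<le> m \<Longrightarrow> norm (X k - X m) < e" for k M e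
    using bound[OF that] by (intro summableI_nonneg_bounded[where x = e]) auto
  obtain M1 where M1: "\<And>k m. M1 \<le> k \<Longrightarrow> M1 \<le> m \<Longrightarrow> norm (X k - X m) < 1"
    using CauchyD[OF X, of 1] by auto
  have "summable (\<lambda>n. norm (l1_nth (X M1) n - l n))"
    using sumbd[where k = M1 and M = M1 and e = 1] M1 by blast
  from summable_norm_add[OF this summ[of "- X M1"]]
  have "summable (\<lambda>n. norm (l n))"
    by (simp add: uminus_l1_sum.rep_eq)
  then obtain L where L: "l1_nth L = l" by (metis L1_sum_inverse mem_Collect_eq)
  have "X \<longlonglongrightarrow> L"
  proof (rule LIMSEQ_I)
    fix e :: real assume "0 < e"
    with X obtain M where M: "\<And>k m. M \<le> k \<Longrightarrow> M \<le> m \<Longrightarrow> norm (X k - X m) < e / 2"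
      using CauchyD[OF X, of "e / 2"] by auto
    have "norm (X k - L) < e" if k: "M \<le> k" for k
    proof -
      have "norm (X k - L) \<le> e / 2"
        unfolding norm_l1_sum.rep_eq diff L
        using sumbd[where k = k and M = M and e = "e / 2"]
          bound[where k = k and M = M and e = "e / 2"] M[OF k]
        by (intro suminf_le_const) auto
      with \<open>0 < e\<close> show ?thesis by simp
    qed
    then show "\<exists>M. \<forall>k\<ge>M. norm (X k - L) < e" by blast
  qed
  then show "convergent X" by (auto simp: convergent_def)
qed

end

theory Submission
  imports Defs
begin

text \<open>
  By Pelczynski's decomposition method it is enough to embed \<open>(\<Sum> \<F>(X))\<^sub>\<ell>\<^sub>1\<close> as a complemented subspace
  of \<open>\<F>(X)\<close>. A partition of unity cuts \<open>X\<close> into dyadic annuli. Every annulus is shrunk into the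
  unit ball, a multiple of an isometry on the level of free spaces, and infinitely many translates of
  each of these pieces are placed in disjoint balls of \<open>X\<close>. Each vector
  of the \<open>n\<close>-th summand is distributed over the \<open>n\<close>-th copies of the annuli; localizing to the
  balls, undoing the scaling and adding up recovers it. All sums involved are locally finite with
  uniformly bounded multiplicity, so the maps are Lipschitz and extend linearly to the free spaces.
\<close>

section \<open>Operators on sums in the sense of \<open>\<ell>\<^sub>1\<close>\<close>

lemma l1_nth_simps [simp]:
  "l1_nth 0 n = 0" "l1_nth (y + z) n = l1_nth y n + l1_nth z n"
  "l1_nth (y - z) n = l1_nth y n - l1_nth z n" "l1_nth (- y) n = - l1_nth y n"
  "l1_nth (c *\<^sub>R y) n = c *\<^sub>R l1_nth y n"
  by (transfer; simp)+

lemma l1_sum_eqI: "(\<And>n. l1_nth y n = l1_nth z n) \<Longrightarrow> y = z"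
  by transfer auto

lemma summable_norm_l1_nth: "summable (\<lambda>n. norm (l1_nth y n))"
  using l1_nth[of y] by simp

lemma sum_norm_l1_nth_le: "(\<Sum>n<N. norm (l1_nth y n)) \<le> norm y"
  unfolding norm_l1_sum.rep_eq by (intro sum_le_suminf summable_norm_l1_nth) auto

lemma norm_l1_nth_le: "norm (l1_nth y n) \<le> norm y"
  using sum_norm_l1_nth_le[of y "Suc n"] sum_nonneg[of "{..<n}" "\<lambda>n. norm (l1_nth y n)"] by simp

lemma bounded_linear_l1_nth: "bounded_linear (\<lambda>y. l1_nth y n)"
  by (rule bounded_linear_intro[where K = 1]) (auto simp: norm_l1_nth_le)

text \<open>A bound on all finite partial sums gives both summability and the norm estimate, so
  operators into the sum can be built from finite estimates alone.\<close>

lemma ex_l1_sum_bounded: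
  fixes f :: "nat \<Rightarrow> 'b::real_normed_vector"
  assumes "\<And>N. (\<Sum>n<N. norm (f n)) \<le> C"
  shows "\<exists>y. l1_nth y = f \<and> norm y \<le> C"
proof -
  have s: "summable (\<lambda>n. norm (f n))"
    using assms by (intro summableI_nonneg_bounded[where x = C]) auto
  then obtain y where y: "l1_nth y = f"
    by (metis L1_sum_inverse mem_Collect_eq)
  moreover have "norm y \<le> C"
    unfolding norm_l1_sum.rep_eq y using s assms by (intro suminf_le_const) auto
  ultimately show ?thesis by blast
qed

lemma bounded_linear_l1_sum_intro:
  fixes T :: "'a::real_normed_vector \<Rightarrow> 'b::real_normed_vector l1_sum"
  assumes "\<And>n. linear (\<lambda>x. l1_nth (T x) n)" and "\<And>x N. (\<Sum>n<N. norm (l1_nth (T x) n)) \<le> norm x * C"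
  shows "bounded_linear T"
proof (rule bounded_linear_intro[where K = C])
  show "T (x + y) = T x + T y" for x y
    by (intro l1_sum_eqI) (simp add: linear_add[OF assms(1)])
  show "T (c *\<^sub>R x) = c *\<^sub>R T x" for c x
    by (intro l1_sum_eqI) (simp add: linear_cmul[OF assms(1)])
  show "norm (T x) \<le> norm x * C" for x
    unfolding norm_l1_sum.rep_eq using assms(2) summable_norm_l1_nth
    by (intro suminf_le_const) auto
qed

section \<open>Inclusions of the summands and shifts\<close>

lift_definition l1_single :: "nat \<Rightarrow> 'b::real_normed_vector \<Rightarrow> 'b l1_sum" is "\<lambda>m x n. if n = m then x else 0"
  subgoal for m x by (rule summable_finite[of "{m}"]) auto
  done

lemma norm_l1_single: "norm (l1_single m x) = norm x"
proof transfer
  fix m and x :: 'a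
  show "(\<Sum>n. norm (if n = m then x else 0)) = norm x"
    using suminf_finite[of "{m}" "\<lambda>n. norm (if n = m then x else 0)"] by auto
qed

lemma bounded_linear_l1_single: "bounded_linear (l1_single m)"
proof (rule bounded_linear_intro[where K = 1])
  show "l1_single m (x + y) = l1_single m x + l1_single m y" for x y :: 'a
    by transfer auto
  show "l1_single m (c *\<^sub>R x) = c *\<^sub>R l1_single m x" for c and x :: 'a
    by transfer auto
qed (simp add: norm_l1_single)

lift_definition l1_cons :: "'b::real_normed_vector \<Rightarrow> 'b l1_sum \<Rightarrow> 'b l1_sum" is
  "\<lambda>x y n. case n of 0 \<Rightarrow> x | Suc m \<Rightarrow> y m"
  by (subst summable_Suc_iff[symmetric]) simp

lift_definition l1_tail :: "'b::real_normed_vector l1_sum \<Rightarrow> 'b l1_sum" is "\<lambda>y n. y (Suc n)"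
  by (subst summable_Suc_iff)

lemma bounded_linear_l1_cons:
  assumes "bounded_linear f" "bounded_linear g"
  shows "bounded_linear (\<lambda>x. l1_cons (f x) (g x))"
proof -
  obtain A B where A: "\<And>x. norm (f x) \<le> norm x * A" and B: "\<And>x. norm (g x) \<le> norm x * B"
    using assms bounded_linear.bounded by metis
  show ?thesis
  proof (rule bounded_linear_l1_sum_intro[where C = "A + B"])
    show "linear (\<lambda>x. l1_nth (l1_cons (f x) (g x)) n)" for n
      using bounded_linear.linear[OF assms(1)]
        bounded_linear.linear[OF bounded_linear_compose[OF bounded_linear_l1_nth assms(2)]]
      by (cases n) (simp_all add: l1_cons.rep_eq)
    fix x N
    have "(\<Sum>n<N. norm (l1_nth (l1_cons (f x) (g x)) n)) \<le> (\<Sum>n<Suc N. norm (l1_nth (l1_cons (f x) (g x)) n))"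
      by simp
    also have "\<dots> = norm (f x) + (\<Sum>n<N. norm (l1_nth (g x) n))"
      unfolding sum.lessThan_Suc_shift by (simp add: l1_cons.rep_eq)
    also have "\<dots> \<le> norm x * (A + B)"
      using A[of x] B[of x] sum_norm_l1_nth_le[of "g x" N] by (simp add: distrib_left)
    finally show "(\<Sum>n<N. norm (l1_nth (l1_cons (f x) (g x)) n)) \<le> norm x * (A + B)" .
  qed
qed

lemma bounded_linear_l1_tail: "bounded_linear l1_tail"
proof (rule bounded_linear_l1_sum_intro[where C = 1])
  show "linear (\<lambda>y. l1_nth (l1_tail y) n)" for n
    by (rule linearI) (simp_all add: l1_tail.rep_eq)
  fix y :: "'a l1_sum" and N
  have "(\<Sum>n<N. norm (l1_nth (l1_tail y) n)) \<le> (\<Sum>n<Suc N. norm (l1_nth y n))"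
    unfolding sum.lessThan_Suc_shift by (simp add: l1_tail.rep_eq)
  also have "\<dots> \<le> norm y" by (rule sum_norm_l1_nth_le)
  finally show "(\<Sum>n<N. norm (l1_nth (l1_tail y) n)) \<le> norm y * 1" by simp
qed

section \<open>Diagonal operators and operators glued from the summands\<close>

lemma ex_l1_map:
  fixes A :: "'b::real_normed_vector \<Rightarrow> 'c::real_normed_vector"
  assumes "bounded_linear A"
  shows "\<exists>M. bounded_linear M \<and> (\<forall>y n. l1_nth (M y) n = A (l1_nth y n))"
proof -
  obtain K where K: "\<And>x. norm (A x) \<le> norm x * K" "0 \<le> K"
    using bounded_linear.nonneg_bounded[OF assms] by metis
  have bd: "(\<Sum>n<N. norm (A (l1_nth y n))) \<le> norm y * K" for y N
  proof -
    have "(\<Sum>n<N. norm (A (l1_nth y n))) \<le> (\<Sum>n<N. norm (l1_nth y n)) * K"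
      unfolding sum_distrib_right by (intro sum_mono K)
    also have "\<dots> \<le> norm y * K"
      by (intro mult_right_mono K sum_norm_l1_nth_le)
    finally show ?thesis .
  qed
  then have "\<forall>y. \<exists>z. l1_nth z = (\<lambda>n. A (l1_nth y n))"
    using ex_l1_sum_bounded[OF bd] by blast
  then obtain M where M: "\<And>y. l1_nth (M y) = (\<lambda>n. A (l1_nth y n))"
    by metis
  have "bounded_linear M"
    using bounded_linear.linear[OF bounded_linear_compose[OF assms bounded_linear_l1_nth]] bd
    by (intro bounded_linear_l1_sum_intro[where C = K]) (simp_all add: M)
  with M show ?thesis by auto
qed

text \<open>Universal property of the sum: for a uniformly bounded family the series converges
  absolutely, hence in the complete target, and is dominated by \<open>C\<close> times the norm of
  \<open>y\<close>.\<close>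

lemma ex_l1_sum_operator:
  fixes S :: "nat \<Rightarrow> 'b::real_normed_vector \<Rightarrow> 'c::banach"
  assumes S: "\<And>n. bounded_linear (S n)" and C: "\<And>n x. norm (S n x) \<le> C * norm x"
  shows "\<exists>T. bounded_linear T \<and> (\<forall>y. (\<lambda>n. S n (l1_nth y n)) sums T y)"
proof -
  have summ: "summable (\<lambda>n. norm (S n (l1_nth y n)))" for y
    by (rule summable_comparison_test'[OF summable_mult[OF summable_norm_l1_nth[of y], of C], of 0])
      (simp add: C)
  define T where "T y = (\<Sum>n. S n (l1_nth y n))" for y
  have sums: "(\<lambda>n. S n (l1_nth y n)) sums T y" for y
    unfolding T_def by (rule summable_sums[OF summable_norm_cancel[OF summ]])
  have "bounded_linear T"
  proof (rule bounded_linear_intro[where K = C])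
    have lin: "linear (S n)" for n by (rule bounded_linear.linear[OF S])
    show "T (y + z) = T y + T z" for y z
      using sums_unique2[OF sums[of "y + z"]] sums_add[OF sums[of y] sums[of z]]
      by (simp add: linear_add[OF lin])
    show "T (c *\<^sub>R y) = c *\<^sub>R T y" for c y
      using sums_unique2[OF sums[of "c *\<^sub>R y"]] sums_scaleR_right[OF sums[of y], of c]
      by (simp add: linear_cmul[OF lin])
    show "norm (T y) \<le> norm y * C" for y
    proof -
      have "norm (T y) \<le> (\<Sum>n. norm (S n (l1_nth y n)))"
        unfolding T_def by (rule summable_norm[OF summ])
      also have "\<dots> \<le> (\<Sum>n. C * norm (l1_nth y n))"
        by (intro suminf_le C summ summable_mult summable_norm_l1_nth)
      also have "\<dots> = norm y * C"
        by (simp add: suminf_mult summable_norm_l1_nth norm_l1_sum.rep_eq mult.commute)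
      finally show ?thesis .
    qed
  qed
  with sums show ?thesis by blast
qed

text \<open>The error after \<open>m\<close> terms is the tail of a convergent series of norms.
  Hence a bounded operator on the sum is determined by its restrictions to the summands.\<close>

lemma sums_l1_single: "(\<lambda>n. l1_single n (l1_nth y n)) sums y"
  unfolding sums_def
proof (rule LIMSEQ_I)
  fix e :: real assume "0 < e"
  then obtain N where N: "\<And>m. N \<le> m \<Longrightarrow> norm (\<Sum>n. norm (l1_nth y (n + m))) < e"
    using suminf_exist_split[OF _ summable_norm_l1_nth[of y]] by metis
  have "norm ((\<Sum>n<m. l1_single n (l1_nth y n)) - y) < e" if "N \<le> m" for m
  proof -
    have nth: "l1_nth (\<Sum>n<k. l1_single n (l1_nth y n)) i = (if i < k then l1_nth y i else 0)" for k i
      by (induction k) (auto simp: l1_single.rep_eq less_Suc_eq)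
    have "norm ((\<Sum>n<m. l1_single n (l1_nth y n)) - y) = (\<Sum>n. norm (if n < m then 0 else l1_nth y n))"
      unfolding norm_l1_sum.rep_eq by (intro suminf_cong) (simp add: nth)
    also have "\<dots> = (\<Sum>n. norm (l1_nth y (n + m)))"
    proof -
      have "summable (\<lambda>n. norm (if n < m then 0 else l1_nth y n))"
        by (rule summable_comparison_test'[OF summable_norm_l1_nth[of y], of 0]) auto
      from suminf_split_initial_segment[OF this, of m] show ?thesis by simp
    qed
    finally show ?thesis using N[OF that] by simp
  qed
  then show "\<exists>N. \<forall>m\<ge>N. norm ((\<Sum>n<m. l1_single n (l1_nth y n)) - y) < e" by blast
qed

text \<open>
  Splitting off \<open>ker R\<close> on both sides, the isomorphism shifts the \<open>ker R\<close>-components one place to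
  the right and inserts that of its argument in front.
\<close>

lemma pelczynski_decomposition:
  fixes R :: "'b::real_normed_vector \<Rightarrow> 'b l1_sum"
  assumes R: "bounded_linear R" and S: "bounded_linear S" and RS: "\<And>y. R (S y) = y"
  shows "\<exists>T :: 'b \<Rightarrow> 'b l1_sum. bounded_linear T \<and> bij T \<and> bounded_linear (inv T)"
proof -
  \<comment> \<open>As \<open>R\<close> is a left inverse of \<open>S\<close>, \<open>P\<close>
    projects onto the range of \<open>S\<close> along \<open>ker R\<close>, and \<open>Q\<close>
    projects onto \<open>ker R\<close>.\<close>
  define P where "P x = S (R x)" for x
  define Q where "Q x = x - P x" for x
  have P: "bounded_linear P"
    unfolding P_def by (rule bounded_linear_compose[OF S R])
  have Q: "bounded_linear Q"
    unfolding Q_def by (rule bounded_linear_sub[OF bounded_linear_ident P])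
  note lin = linear_add[OF bounded_linear.linear] linear_diff[OF bounded_linear.linear]
  have RP: "R (P x) = R x" and RQ: "R (Q x) = 0" for x
    by (simp_all add: P_def Q_def RS lin[OF R])
  have PP: "P (P x) = P x" and PQ: "P (Q x) = 0" and QP: "Q (P x) = 0" and QQ: "Q (Q x) = Q x"
    and QS: "Q (S y) = 0" for x y
    using RP RQ by (simp_all add: P_def Q_def lin[OF R] lin[OF S] RS
      linear_0[OF bounded_linear.linear[OF S]])
  obtain MP MQ where MP: "bounded_linear MP" "\<And>y n. l1_nth (MP y) n = P (l1_nth y n)"
    and MQ: "bounded_linear MQ" "\<And>y n. l1_nth (MQ y) n = Q (l1_nth y n)"
    using ex_l1_map[OF P] ex_l1_map[OF Q] by metis
  define T where "T f = MP (R f) + MQ (l1_cons f (R f))" for f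
  \<comment> \<open>The inverse shift: the \<open>P\<close>-components stay in place, the
    \<open>ker R\<close>-components move one place to the left, and the one at index 0 becomes the
    \<open>ker R\<close>-component of the result.\<close>
  define U where "U z = S (MP z + l1_tail (MQ z)) + Q (l1_nth z 0)" for z
  have T: "bounded_linear T"
    unfolding T_def
    by (intro bounded_linear_add bounded_linear_compose[OF MP(1)] bounded_linear_compose[OF MQ(1)]
      bounded_linear_l1_cons bounded_linear_ident R)
  have U: "bounded_linear U"
    unfolding U_def
    by (intro bounded_linear_add bounded_linear_compose[OF S] bounded_linear_compose[OF Q]
      bounded_linear_compose[OF bounded_linear_l1_tail] MP MQ bounded_linear_l1_nth)
  have "T (U z) = z" for z
  proof (rule l1_sum_eqI)
    fix n
    have "R (U z) = MP z + l1_tail (MQ z)" "Q (U z) = Q (l1_nth z 0)"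
      by (simp_all add: U_def lin[OF R] lin[OF Q] RS RQ QS QQ)
    then show "l1_nth (T (U z)) n = l1_nth z n"
      by (cases n) (simp_all add: T_def MP MQ l1_cons.rep_eq l1_tail.rep_eq lin[OF P] lin[OF Q]
        PP PQ QP QQ, simp_all add: Q_def)
  qed
  moreover have "U (T f) = f" for f
  proof -
    have "MP (T f) + l1_tail (MQ (T f)) = R f"
      by (rule l1_sum_eqI) (simp add: T_def MP MQ l1_cons.rep_eq l1_tail.rep_eq lin[OF P] lin[OF Q]
        PP PQ QP QQ, simp add: Q_def)
    moreover have "Q (l1_nth (T f) 0) = Q f"
      by (simp add: T_def MP MQ l1_cons.rep_eq lin[OF Q] QP QQ)
    ultimately show ?thesis
      by (simp add: U_def Q_def P_def)
  qed
  ultimately have "bij T" "inv T = U"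
    using o_bij[of U T] inv_unique_comp[of T U] by (auto simp: fun_eq_iff)
  with T U show ?thesis by auto
qed


section \<open>Linearization of Lipschitz maps\<close>

lemma abs_lip0_apply_diff_le: "\<bar>lip0_apply g x - lip0_apply g y\<bar> \<le> norm g * dist x y"
  by transfer (auto intro: lip_const_upper)

lemma lip0_apply_zero [simp]: "lip0_apply g 0 = 0"
  by transfer simp

lemma ex_lip0:
  fixes f :: "'a::{metric_space, zero} \<Rightarrow> real"
  assumes "f 0 = 0" "\<And>x y. \<bar>f x - f y\<bar> \<le> C * dist x y" "0 \<le> C"
  shows "\<exists>g. lip0_apply g = f \<and> norm g \<le> C"
proof -
  have "C-lipschitz_on UNIV f"
    using assms by (auto simp: lipschitz_on_def dist_real_def)
  then obtain g where "lip0_apply g = f"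
    using assms(1) by (metis (mono_tags, lifting) Lip0_inverse mem_Collect_eq)
  then show ?thesis
    using lip_const_least[OF assms(3,2)] by (metis norm_lip0.rep_eq)
qed

lift_definition dirac :: "'a::{metric_space, zero} \<Rightarrow> 'a lipschitz_free" is evaluation
  by (rule subsetD[OF closure_subset span_base]) auto

lemma linear_functional_of: "linear functional_of"
  by (rule linearI; transfer; simp)

lemma functional_of_dirac [simp]: "blinfun_apply (functional_of (dirac x)) g = lip0_apply g x"
  by (simp add: dirac.rep_eq evaluation.rep_eq)

lemma lipschitz_free_eqI:
  "(\<And>g. blinfun_apply (functional_of u) g = blinfun_apply (functional_of v) g) \<Longrightarrow> u = v"
  by (metis blinfun_eqI functional_of_inject)

lemma dirac_zero [simp]: "dirac 0 = 0"
  by (rule lipschitz_free_eqI) (simp add: linear_0[OF linear_functional_of])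

lemma norm_dirac_diff_le: "norm (dirac x - dirac y) \<le> dist x y"
  unfolding norm_lipschitz_free.rep_eq
proof (rule norm_blinfun_bound)
  fix g
  show "norm (blinfun_apply (functional_of (dirac x - dirac y)) g) \<le> dist x y * norm g"
    using abs_lip0_apply_diff_le[of g x y]
    by (simp add: linear_diff[OF linear_functional_of] blinfun.diff_left mult.commute)
qed simp

text \<open>Density holds by construction inside the dual of \<open>'a lip0\<close>; the linear
  isometry \<open>functional_of\<close> carries it back to the free space.\<close>

lemma span_dirac_dense: "closure (span (range dirac)) = UNIV"
proof -
  have "u \<in> closure (span (range dirac))" for u :: "'a lipschitz_free"
    unfolding closure_approachable
  proof (intro allI impI)
    fix e :: real assume "0 < e"
    have "functional_of u \<in> closure (span (range evaluation))"
      by (rule functional_of)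
    then obtain v where v: "v \<in> span (range evaluation)" "dist v (functional_of u) < e"
      using \<open>0 < e\<close> unfolding closure_approachable by blast
    have "range (evaluation :: 'a \<Rightarrow> _) = functional_of ` range dirac"
      by (auto simp: dirac.rep_eq image_image)
    then have "v \<in> functional_of ` span (range dirac)"
      using v(1) by (simp only: linear_span_image[OF linear_functional_of])
    then obtain w where "w \<in> span (range dirac)" "v = functional_of w"
      by blast
    with v(2) show "\<exists>w\<in>span (range dirac). dist w u < e"
      by (auto simp: dist_functional_of)
  qed
  then show ?thesis by blast
qed

text \<open>The difference of the two operators vanishes on a dense span and is continuous.\<close>

lemma bounded_linear_eq_on_dirac:
  assumes A: "bounded_linear A" and B: "bounded_linear B" and "\<And>x. A (dirac x) = B (dirac x)"
  shows "A u = B u"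
proof -
  have D: "bounded_linear (\<lambda>u. A u - B u)"
    by (rule bounded_linear_sub[OF A B])
  have "A u - B u = 0" if "u \<in> span (range dirac)" for u
    by (rule linear_eq_0_on_span[OF bounded_linear.linear[OF D] _ that]) (auto simp: assms(3))
  then have "A u - B u = 0"
    by (rule continuous_constant_on_closure[of "span (range dirac)", rotated])
      (simp_all add: span_dirac_dense linear_continuous_on[OF D])
  then show ?thesis by simp
qed

text \<open>
  The extension is the restriction of the adjoint of \<open>g \<mapsto> (x \<mapsto> \<langle>f x, g\<rangle>)\<close>; it is therefore
  described by its values on Lipschitz functions.
\<close>

lemma ex_linearization:
  fixes f :: "'a::{metric_space, zero} \<Rightarrow> 'b::{metric_space, zero} lipschitz_free"
  assumes f0: "f 0 = 0" and f: "\<And>x y. norm (f x - f y) \<le> C * dist x y" and C: "0 \<le> C"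
  shows "\<exists>L. bounded_linear L \<and> (\<forall>x. L (dirac x) = f x) \<and> (\<forall>u. norm (L u) \<le> C * norm u) \<and>
    (\<forall>g h u. (\<forall>x. lip0_apply h x = functional_of (f x) g) \<longrightarrow> functional_of (L u) g = functional_of u h)"
proof -
  have fz: "functional_of (f 0) g = 0" for g
    by (simp add: f0 linear_0[OF linear_functional_of])
  have fl: "\<bar>functional_of (f x) g - functional_of (f y) g\<bar> \<le> C * norm g * dist x y" for x y g
  proof -
    have "\<bar>functional_of (f x) g - functional_of (f y) g\<bar> = norm (functional_of (f x - f y) g)"
      by (simp add: linear_diff[OF linear_functional_of] blinfun.diff_left)
    also have "\<dots> \<le> norm (f x - f y) * norm g"
      unfolding norm_lipschitz_free.rep_eq by (rule norm_blinfun)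
    also have "\<dots> \<le> C * dist x y * norm g"
      by (intro mult_right_mono f) simp
    finally show ?thesis by (simp add: mult_ac)
  qed
  have "\<forall>g. \<exists>h. lip0_apply h = (\<lambda>x. functional_of (f x) g) \<and> norm h \<le> C * norm g"
    using ex_lip0[OF fz fl] C by simp
  then obtain B where B: "\<And>g x. lip0_apply (B g) x = functional_of (f x) g"
      "\<And>g. norm (B g) \<le> C * norm g"
    by metis
  \<comment> \<open>Elements of \<open>lip0\<close> are determined by their values; this yields
    linearity of \<open>B\<close> and lets any given \<open>h\<close> with the right values replace
    \<open>B g\<close>.\<close>
  have Beq: "h = B g" if "\<And>x. lip0_apply h x = functional_of (f x) g" for h g
    using that B by (metis ext lip0_apply_inject)
  have Bbl: "bounded_linear B"
  proof (rule bounded_linear_intro[where K = C])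
    show "B (g + h) = B g + B h" for g h
      by (rule Beq[symmetric]) (simp add: plus_lip0.rep_eq B blinfun.add_right)
    show "B (c *\<^sub>R g) = c *\<^sub>R B g" for c g
      by (rule Beq[symmetric]) (simp add: scaleR_lip0.rep_eq B blinfun.scaleR_right)
  qed (simp add: B mult.commute)
  define A where "A v = v o\<^sub>L Blinfun B" for v :: "'a lip0 \<Rightarrow>\<^sub>L real"
  have Ag: "blinfun_apply (A v) g = v (B g)" for v g
    by (simp add: A_def bounded_linear_Blinfun_apply[OF Bbl])
  have A: "bounded_linear A"
    unfolding A_def by (intro bounded_linear_intros)
  have Aev: "A (evaluation x) = functional_of (f x)" for x
    by (rule blinfun_eqI) (simp add: Ag evaluation.rep_eq B)
  let ?V = "closure (span (range evaluation)) :: ('b lip0 \<Rightarrow>\<^sub>L real) set"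
  \<comment> \<open>The adjoint sends evaluations into the free space of the target. Since that
    space is a closed subspace, linearity and continuity extend this to the whole free space, so the
    restriction is well defined.\<close>
  have "A ` span (range evaluation) = span (A ` range evaluation)"
    by (simp add: linear_span_image[OF bounded_linear.linear[OF A]])
  also have "\<dots> \<subseteq> ?V"
    by (rule span_minimal[OF _ subspace_free]) (auto simp: Aev functional_of)
  finally have "A ` closure (span (range evaluation)) \<subseteq> ?V"
    by (rule image_closure_subset[OF linear_continuous_on[OF A] closed_closure])
  then have V: "A (functional_of u) \<in> ?V" for u
    using functional_of by blast
  define L where "L u = Lipschitz_free (A (functional_of u))" for u
  have L: "functional_of (L u) = A (functional_of u)" for u
    unfolding L_def by (rule Lipschitz_free_inverse[OF V])
  have Lb: "norm (L u) \<le> C * norm u" for u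
    unfolding norm_lipschitz_free.rep_eq L
  proof (rule norm_blinfun_bound)
    show "norm (A (functional_of u) g) \<le> C * norm (functional_of u) * norm g" for g
    proof -
      have "norm (A (functional_of u) g) \<le> norm (functional_of u) * norm (B g)"
        unfolding Ag by (rule norm_blinfun)
      also have "\<dots> \<le> norm (functional_of u) * (C * norm g)"
        by (intro mult_left_mono B) simp
      finally show ?thesis by (simp add: mult_ac)
    qed
  qed (simp add: C)
  have Lbl: "bounded_linear L"
  proof (rule bounded_linear_intro[where K = C])
    note lin = linear_add[OF linear_functional_of] linear_cmul[OF linear_functional_of]
      linear_add[OF bounded_linear.linear[OF A]] linear_cmul[OF bounded_linear.linear[OF A]]
    show "L (u + v) = L u + L v" for u v
      by (rule lipschitz_free_eqI) (simp add: L lin)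
    show "L (c *\<^sub>R u) = c *\<^sub>R L u" for c u
      by (rule lipschitz_free_eqI) (simp add: L lin)
  qed (use Lb in \<open>simp add: mult.commute\<close>)
  have Ld: "L (dirac x) = f x" for x
    using functional_of_inject[of "L (dirac x)" "f x"] by (simp add: L dirac.rep_eq Aev)
  have Lg: "functional_of (L u) g = functional_of u h"
    if "\<forall>x. lip0_apply h x = functional_of (f x) g" for g h u
    using Beq[of h g] that by (simp add: L Ag)
  show ?thesis
    by (intro exI[of _ L] conjI allI impI) (fact Lbl Ld Lb Lg)+
qed

text \<open>Unless \<open>norm v\<close> is at most \<open>e\<close>, the number
  \<open>norm v - e\<close> is too small to be an operator bound; a vector violating it, normalized
  and given the right sign, is the witness.\<close>

lemma blinfun_almost_norming:
  fixes v :: "'a::real_normed_vector \<Rightarrow>\<^sub>L real"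
  assumes "0 < e"
  shows "\<exists>g. norm g \<le> 1 \<and> norm v - e \<le> v g"
proof (cases "norm v \<le> e")
  case True
  then show ?thesis by (intro exI[of _ 0]) (simp add: blinfun.zero_right)
next
  case False
  then obtain g where g: "(norm v - e) * norm g < \<bar>v g\<bar>"
    using norm_blinfun_bound[of "norm v - e" v] assms
    by (metis diff_ge_0_iff_ge less_eq_real_def linorder_not_le diff_less_eq less_add_same_cancel1 real_norm_def)
  then have "g \<noteq> 0" by (auto simp: blinfun.zero_right)
  then have "norm v - e \<le> \<bar>v g\<bar> / norm g"
    using g by (simp add: pos_le_divide_eq)
  also have "\<dots> = v ((sgn (v g) / norm g) *\<^sub>R g)"
    by (simp add: blinfun.scaleR_right mult_sgn_abs abs_sgn[of "v g"])
  finally have "norm v - e \<le> v ((sgn (v g) / norm g) *\<^sub>R g)" .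
  moreover have "norm ((sgn (v g) / norm g) *\<^sub>R g) \<le> 1"
    using \<open>g \<noteq> 0\<close> by (simp add: abs_sgn_eq)
  ultimately show ?thesis by blast
qed

text \<open>
  Testing against almost norming functions makes the Hahn--Banach theorem unnecessary here.
\<close>

lemma ex_linearization_l1_sum:
  fixes f :: "'a::{metric_space, zero} \<Rightarrow> 'b::{metric_space, zero} lipschitz_free l1_sum"
  assumes f0: "f 0 = 0" and f: "\<And>x y. norm (f x - f y) \<le> C * dist x y" and C: "0 \<le> C"
  shows "\<exists>L. bounded_linear L \<and> (\<forall>x. L (dirac x) = f x)"
proof -
  let ?f = "\<lambda>n x. l1_nth (f x) n"
  have f0': "?f n 0 = 0" for n by (simp add: f0)
  have f': "norm (?f n x - ?f n y) \<le> C * dist x y" for n x y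
    using norm_l1_nth_le[of "f x - f y" n] f[of x y] by simp
  have "\<forall>n. \<exists>L. bounded_linear L \<and> (\<forall>x. L (dirac x) = ?f n x) \<and>
    (\<forall>g h u. (\<forall>x. lip0_apply h x = functional_of (?f n x) g) \<longrightarrow> functional_of (L u) g = functional_of u h)"
    using ex_linearization[OF f0' f' C] by blast
  then obtain L where L: "\<And>n. bounded_linear (L n)" "\<And>n x. L n (dirac x) = ?f n x"
    "\<And>n g h u. (\<And>x. lip0_apply h x = functional_of (?f n x) g) \<Longrightarrow>
      functional_of (L n u) g = functional_of u h"
    by metis
  have bd: "(\<Sum>n<N. norm (L n u)) \<le> norm u * C" for N u
  proof (rule field_le_epsilon)
    fix e :: real assume "0 < e"
    \<comment> \<open>The tolerance \<open>e\<close> is shared among the \<open>N\<close> summands;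
      the extra 1 keeps the denominator positive for \<open>N = 0\<close>.\<close>
    then have "0 < e / (real N + 1)" by simp
    then have "\<forall>n. \<exists>g. norm g \<le> 1 \<and>
        norm (functional_of (L n u)) - e / (real N + 1) \<le> functional_of (L n u) g"
      using blinfun_almost_norming by blast
    then obtain g where g: "\<And>n. norm (g n) \<le> 1"
      "\<And>n. norm (functional_of (L n u)) - e / (real N + 1) \<le> functional_of (L n u) (g n)"
      by metis
    have "\<exists>h. lip0_apply h = (\<lambda>x. functional_of (?f n x) (g n))" for n
    proof -
      have "\<bar>functional_of (?f n x) (g n) - functional_of (?f n y) (g n)\<bar> \<le> C * dist x y" for x y
      proof -
        have "\<bar>functional_of (?f n x) (g n) - functional_of (?f n y) (g n)\<bar>
          = norm (functional_of (?f n x - ?f n y) (g n))"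
          by (simp add: linear_diff[OF linear_functional_of] blinfun.diff_left)
        also have "\<dots> \<le> norm (?f n x - ?f n y) * norm (g n)"
          unfolding norm_lipschitz_free.rep_eq by (rule norm_blinfun)
        also have "\<dots> \<le> C * dist x y * 1"
          by (intro mult_mono f' g) (simp_all add: C)
        finally show ?thesis by simp
      qed
      then show ?thesis
        using ex_lip0[of "\<lambda>x. functional_of (?f n x) (g n)" C] C
        by (auto simp: f0 linear_0[OF linear_functional_of])
    qed
    then obtain h where h: "\<And>n x. lip0_apply (h n) x = functional_of (?f n x) (g n)" by metis
    have hs: "lip0_apply (\<Sum>n<M. h n) x = (\<Sum>n<M. functional_of (?f n x) (g n))" for x M
      by (induction M) (simp_all add: zero_lip0.rep_eq plus_lip0.rep_eq h)
    \<comment> \<open>The norm of the sum enters here: the coordinates of \<open>f x - f y\<close>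
      have total norm at most \<open>C * dist x y\<close>, so one test function handles all
      \<open>N\<close> coordinates with a constant independent of \<open>N\<close>.\<close>
    have "norm (\<Sum>n<N. h n) \<le> C"
      unfolding norm_lip0.rep_eq
    proof (rule lip_const_least[OF C])
      fix x y
      have "\<bar>lip0_apply (\<Sum>n<N. h n) x - lip0_apply (\<Sum>n<N. h n) y\<bar>
        = \<bar>\<Sum>n<N. functional_of (?f n x - ?f n y) (g n)\<bar>"
        by (simp add: hs sum_subtractf linear_diff[OF linear_functional_of] blinfun.diff_left)
      also have "\<dots> \<le> (\<Sum>n<N. norm (?f n x - ?f n y))"
      proof (rule order_trans[OF sum_abs], rule sum_mono)
        fix n
        have "norm (functional_of (?f n x - ?f n y) (g n)) \<le> norm (?f n x - ?f n y) * norm (g n)"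
          unfolding norm_lipschitz_free.rep_eq by (rule norm_blinfun)
        also have "\<dots> \<le> norm (?f n x - ?f n y)"
          using g(1)[of n] by (simp add: mult_left_le)
        finally show "\<bar>functional_of (?f n x - ?f n y) (g n)\<bar> \<le> norm (?f n x - ?f n y)" by simp
      qed
      also have "\<dots> \<le> C * dist x y"
        using sum_norm_l1_nth_le[of "f x - f y" N] f[of x y] by simp
      finally show "\<bar>lip0_apply (\<Sum>n<N. h n) x - lip0_apply (\<Sum>n<N. h n) y\<bar> \<le> C * dist x y" .
    qed
    then have le: "functional_of u (\<Sum>n<N. h n) \<le> norm u * C"
      using norm_blinfun[of "functional_of u" "\<Sum>n<N. h n"]
        mult_left_mono[of _ C "norm (functional_of u)"]
      unfolding norm_lipschitz_free.rep_eq by fastforce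
    have "(\<Sum>n<N. norm (L n u) - e / (real N + 1)) \<le> (\<Sum>n<N. functional_of (L n u) (g n))"
      using g(2) by (intro sum_mono) (simp add: norm_lipschitz_free.rep_eq)
    also have "\<dots> = functional_of u (\<Sum>n<N. h n)"
      unfolding blinfun.sum_right by (intro sum.cong L(3)) (simp_all add: h)
    finally have "(\<Sum>n<N. norm (L n u)) - real N * (e / (real N + 1)) \<le> norm u * C"
      using le by (simp add: sum_subtractf)
    moreover have "real N * (e / (real N + 1)) \<le> e"
      using \<open>0 < e\<close> by (simp add: field_simps)
    ultimately show "(\<Sum>n<N. norm (L n u)) \<le> norm u * C + e" by simp
  qed
  then have "\<forall>u. \<exists>y. l1_nth y = (\<lambda>n. L n u)"
    using ex_l1_sum_bounded[OF bd] by blast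
  then obtain K where K: "\<And>u. l1_nth (K u) = (\<lambda>n. L n u)" by metis
  have "bounded_linear K"
    using bd bounded_linear.linear[OF L(1)] by (intro bounded_linear_l1_sum_intro[where C = C]) (simp_all add: K)
  moreover have "K (dirac x) = f x" for x
    by (rule l1_sum_eqI) (simp add: K L)
  ultimately show ?thesis by blast
qed


section \<open>A complemented copy of the sum\<close>

text \<open>For two given points both sums may be taken over the union of their index sets, at most
  \<open>2 * N\<close> terms, each contributing at most \<open>C * dist x y\<close>.\<close>

lemma lipschitz_sum_finite_support:
  fixes t :: "'i \<Rightarrow> 'a::metric_space \<Rightarrow> 'b::real_normed_vector"
  assumes t: "\<And>i x y. norm (t i x - t i y) \<le> C * dist x y"
    and K: "\<And>x. finite (K x)" "\<And>x. card (K x) \<le> N" "\<And>x i. i \<notin> K x \<Longrightarrow> t i x = 0" and C: "0 \<le> C"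
  shows "norm ((\<Sum>i\<in>K x. t i x) - (\<Sum>i\<in>K y. t i y)) \<le> 2 * real N * C * dist x y"
proof -
  let ?U = "K x \<union> K y"
  have "(\<Sum>i\<in>K x. t i x) = (\<Sum>i\<in>?U. t i x)" "(\<Sum>i\<in>K y. t i y) = (\<Sum>i\<in>?U. t i y)"
    using K by (auto intro!: sum.mono_neutral_left)
  then have "norm ((\<Sum>i\<in>K x. t i x) - (\<Sum>i\<in>K y. t i y)) = norm (\<Sum>i\<in>?U. t i x - t i y)"
    by (simp add: sum_subtractf)
  also have "\<dots> \<le> real (card ?U) * (C * dist x y)"
    by (rule sum_norm_bound[OF t])
  also have "card ?U \<le> 2 * N"
    using card_Un_le[of "K x" "K y"] K(2)[of x] K(2)[of y] by linarith
  then have "real (card ?U) * (C * dist x y) \<le> (2 * real N) * (C * dist x y)"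
    using C by (intro mult_right_mono) auto
  finally show ?thesis by (simp add: mult_ac)
qed

text \<open>Product rule: 1 comes from the slope of \<open>G\<close> and \<open>a * b\<close> from
  that of \<open>p\<close>. The bound on \<open>G\<close> is available only where \<open>p\<close>
  is nonzero, so the product is split with \<open>G\<close> evaluated at such a point, by symmetry
  either one.\<close>

lemma lipschitz_cutoff:
  fixes G :: "'a::metric_space \<Rightarrow> 'b::real_normed_vector"
  assumes p: "\<And>x. \<bar>p x\<bar> \<le> 1" "\<And>x y. \<bar>p x - p y\<bar> \<le> a * dist x y"
    and G: "\<And>x y. norm (G x - G y) \<le> dist x y" "\<And>x. p x \<noteq> 0 \<Longrightarrow> norm (G x) \<le> b"
    and a: "0 \<le> a" and b: "0 \<le> b"
  shows "norm (p x *\<^sub>R G x - p y *\<^sub>R G y) \<le> (1 + a * b) * dist x y"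
proof -
  have main: "norm (p x *\<^sub>R G x - p y *\<^sub>R G y) \<le> (1 + a * b) * dist x y" if "p y \<noteq> 0" for x y
  proof -
    have "p x *\<^sub>R G x - p y *\<^sub>R G y = p x *\<^sub>R (G x - G y) + (p x - p y) *\<^sub>R G y"
      by (simp add: algebra_simps)
    then have "norm (p x *\<^sub>R G x - p y *\<^sub>R G y) \<le> \<bar>p x\<bar> * norm (G x - G y) + \<bar>p x - p y\<bar> * norm (G y)"
      by (metis norm_triangle_ineq norm_scaleR)
    also have "\<dots> \<le> 1 * dist x y + (a * dist x y) * b"
      using that a by (intro add_mono mult_mono p G) auto
    finally show ?thesis by (simp add: algebra_simps)
  qed
  consider "p x \<noteq> 0" | "p y \<noteq> 0" | "p x = 0" "p y = 0" by blast
  then show ?thesis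
  proof cases
    case 1
    then show ?thesis using main[of x y] by (simp add: norm_minus_commute dist_commute)
  next
    case 2
    then show ?thesis by (rule main)
  next
    case 3
    then show ?thesis using a b by simp
  qed
qed

section \<open>Cutoff functions on the line\<close>

definition tent :: "real \<Rightarrow> real" where
  "tent s = max 0 (min (2 * s - 1) (2 - s))"

text \<open>The slopes 2 and -1 on the two sides of the peak at 1 make \<open>tent\<close> and its
  dilate by 2 complementary on [1, 2], where they are \<open>2 - s\<close> and
  \<open>s - 1\<close>.\<close>

lemma tent_bounds: "\<bar>tent s\<bar> \<le> 1" and tent_lipschitz: "\<bar>tent s - tent t\<bar> \<le> 2 * \<bar>s - t\<bar>"
  and tent_nonzero: "tent s \<noteq> 0 \<Longrightarrow> 1 / 2 < s \<and> s < 2"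
  and tent_partition: "1 \<le> s \<Longrightarrow> s \<le> 2 \<Longrightarrow> tent s + tent (s / 2) = 1"
  unfolding tent_def by (auto simp: max_def min_def abs_if split: if_splits)

definition plateau :: "real \<Rightarrow> real" where
  "plateau s = max 0 (min 1 (2 - s))"

lemma plateau_bounds: "\<bar>plateau s\<bar> \<le> 1" and plateau_lipschitz: "\<bar>plateau s - plateau t\<bar> \<le> \<bar>s - t\<bar>"
  and plateau_nonzero: "plateau s \<noteq> 0 \<Longrightarrow> s < 2" and plateau_one: "s \<le> 1 \<Longrightarrow> plateau s = 1"
  unfolding plateau_def by (auto simp: max_def min_def abs_if split: if_splits)

text \<open>The weight \<open>l\<close> compensates for the contraction of distances by
  \<open>l\<close>. With the inverse of \<open>l\<close> in its place the same estimate covers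
  dilations.\<close>

lemma norm_scaled_dirac_diff_le:
  fixes x y p :: "'a::real_normed_vector"
  assumes "0 < l"
  shows "norm (l *\<^sub>R dirac (p + x /\<^sub>R l) - l *\<^sub>R dirac (p + y /\<^sub>R l)) \<le> dist x y"
proof -
  have "norm (l *\<^sub>R dirac (p + x /\<^sub>R l) - l *\<^sub>R dirac (p + y /\<^sub>R l))
    = l * norm (dirac (p + x /\<^sub>R l) - dirac (p + y /\<^sub>R l))"
    using assms by (simp flip: scaleR_diff_right)
  also have "\<dots> \<le> l * dist (p + x /\<^sub>R l) (p + y /\<^sub>R l)"
    using assms by (intro mult_left_mono norm_dirac_diff_le) simp
  also have "(p + x /\<^sub>R l) - (p + y /\<^sub>R l) = (x - y) /\<^sub>R l"
    by (simp add: scaleR_diff_right)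
  then have "l * dist (p + x /\<^sub>R l) (p + y /\<^sub>R l) = dist x y"
    using assms by (simp add: dist_norm)
  finally show ?thesis .
qed

section \<open>A dyadic partition of unity away from the origin\<close>

lemma norm_log_floor:
  fixes x :: "'a::real_normed_vector"
  assumes "x \<noteq> 0"
  shows "2 powr \<lfloor>log 2 (norm x)\<rfloor> \<le> norm x" "norm x < 2 * 2 powr \<lfloor>log 2 (norm x)\<rfloor>"
  using floor_log_eq_powr_iff[of "norm x" 2 "\<lfloor>log 2 (norm x)\<rfloor>"] assms
  by (auto simp: powr_add)

definition tent_at :: "int \<Rightarrow> 'a::real_normed_vector \<Rightarrow> real" where
  "tent_at k x = tent (norm x / 2 powr k)"

text \<open>The scales whose open annulus, between half and twice \<open>2 powr k\<close>, can
  contain \<open>x\<close>. At the origin the choice of indices is immaterial, as every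
  \<open>tent_at k\<close> vanishes there.\<close>

definition tent_indices :: "'a::real_normed_vector \<Rightarrow> int set" where
  "tent_indices x = {\<lfloor>log 2 (norm x)\<rfloor>, \<lfloor>log 2 (norm x)\<rfloor> + 1}"

lemma tent_at_outside:
  assumes "k \<notin> tent_indices x"
  shows "tent_at k x = 0"
proof (rule ccontr)
  let ?m = "\<lfloor>log 2 (norm x)\<rfloor>"
  assume "tent_at k x \<noteq> 0"
  then have k: "2 powr k < 2 * norm x" "norm x < 2 * 2 powr k"
    using tent_nonzero[of "norm x / 2 powr k"] by (auto simp: tent_at_def field_simps)
  then have x: "x \<noteq> 0" using powr_gt_zero[of 2 "real_of_int k"] by auto
  have "2 powr k < 2 powr real_of_int (?m + 2)" "2 powr real_of_int ?m < 2 powr real_of_int (k + 1)"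
    using k norm_log_floor[OF x] by (simp_all add: powr_add)
  then have "k < ?m + 2" "?m < k + 1"
    by (simp_all only: powr_less_cancel_iff one_less_numeral_iff num.simps of_int_less_iff
      semiring_norm)
  with assms show False by (auto simp: tent_indices_def)
qed

text \<open>Dividing \<open>norm x\<close> by the largest power of 2 below it gives a number in [1,
  2), where \<open>tent\<close> and its dilate add up to 1.\<close>

lemma sum_tent_at: "x \<noteq> 0 \<Longrightarrow> (\<Sum>k\<in>tent_indices x. tent_at k x) = 1"
  using tent_partition[of "norm x / 2 powr \<lfloor>log 2 (norm x)\<rfloor>"] norm_log_floor[of x]
  by (simp add: tent_indices_def tent_at_def powr_add field_simps)

lemma tent_at_lipschitz: "\<bar>tent_at k x - tent_at k y\<bar> \<le> 2 / 2 powr k * dist x y"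
proof -
  have "\<bar>tent_at k x - tent_at k y\<bar> \<le> 2 * \<bar>norm x / 2 powr k - norm y / 2 powr k\<bar>"
    unfolding tent_at_def by (rule tent_lipschitz)
  also have "\<dots> = 2 / 2 powr k * \<bar>norm x - norm y\<bar>"
    by (simp add: abs_divide flip: diff_divide_distrib)
  also have "\<dots> \<le> 2 / 2 powr k * dist x y"
    unfolding dist_norm by (intro mult_left_mono norm_triangle_ineq3) simp
  finally show ?thesis .
qed

text \<open>
  The annulus carrying \<open>tent_at k\<close>, shrunk by the factor \<open>2 powr (k + 1)\<close>, fits into the unit ball.
  A copy of it is placed around \<open>c (n, k)\<close> for every \<open>n\<close>; the balls \<open>ball (c (n, k)) 2\<close> are disjoint,
  so \<open>plateau\<close> separates all these copies from each other.
\<close>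

lemma ex_section:
  fixes e :: "'a::real_normed_vector"
  assumes e: "norm e = 1"
  shows "\<exists>(R :: 'a lipschitz_free \<Rightarrow> 'a lipschitz_free l1_sum) S.
    bounded_linear R \<and> bounded_linear S \<and> (\<forall>y. R (S y) = y)"
proof -
  \<comment> \<open>The centers lie on a ray with spacing at least 4, so balls of radius 2 are
    disjoint; \<open>Suc\<close> keeps the origin outside all of them, which gives
    \<open>rr 0 = 0\<close>. The index \<open>(n, k)\<close> stands for summand \<open>n\<close> and
    scale \<open>k\<close>.\<close>
  define c where "c j = (4 * real (Suc (to_nat (j :: nat \<times> int)))) *\<^sub>R e" for j
  define l :: "int \<Rightarrow> real" where "l k = 2 * 2 powr k" for k
  have l: "0 < l k" for k by (simp add: l_def)
  have c: "i = j" if "norm (z - c i) < 2" "norm (z - c j) < 2" for i j z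
  proof -
    have "norm (c i - c j) < 4"
      using norm_triangle_ineq4[of "z - c j" "z - c i"] that by simp
    moreover have "norm (c i - c j) = \<bar>4 * real (Suc (to_nat i)) - 4 * real (Suc (to_nat j))\<bar>"
      by (simp add: c_def e flip: scaleR_diff_left)
    ultimately have "real (to_nat i) < real (Suc (to_nat j))" "real (to_nat j) < real (Suc (to_nat i))"
      by (simp_all add: abs_less_iff)
    then have "to_nat i = to_nat j" by (simp only: of_nat_less_iff)
    then show ?thesis by simp
  qed

  \<comment> \<open>Localize to the ball around \<open>c j\<close>, undo the shrinking and its
    weight, and store the result in the summand that \<open>j\<close> belongs to.\<close>
  define r where "r j z = plateau (norm (z - c j)) *\<^sub>R
    l1_single (fst j) (inverse (l (snd j)) *\<^sub>R dirac (l (snd j) *\<^sub>R (z - c j)))" for j z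
  define J where "J z = {j. norm (z - c j) < 2}" for z
  have J: "finite (J z)" "card (J z) \<le> 1" for z
  proof -
    have "J z = {} \<or> (\<exists>j. J z = {j})" using c unfolding J_def by blast
    then show "finite (J z)" "card (J z) \<le> 1" by auto
  qed
  have r_out: "r j z = 0" if "j \<notin> J z" for j z
    using plateau_nonzero[of "norm (z - c j)"] that by (auto simp: J_def r_def)
  have r_lip: "norm (r j x - r j y) \<le> (1 + 1 * 2) * dist x y" for j x y
    unfolding r_def
  proof (rule lipschitz_cutoff)
    let ?G = "\<lambda>z. l1_single (fst j) (inverse (l (snd j)) *\<^sub>R dirac (l (snd j) *\<^sub>R (z - c j)))"
    show "\<bar>plateau (norm (x - c j)) - plateau (norm (y - c j))\<bar> \<le> 1 * dist x y" for x y
      using plateau_lipschitz[of "norm (x - c j)" "norm (y - c j)"]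
        norm_triangle_ineq3[of "x - c j" "y - c j"] by (simp add: dist_norm)
    show G: "norm (?G x - ?G y) \<le> dist x y" for x y
    proof -
      have "norm (?G x - ?G y) = norm (inverse (l (snd j)) *\<^sub>R dirac (0 + (x - c j) /\<^sub>R inverse (l (snd j))) -
        inverse (l (snd j)) *\<^sub>R dirac (0 + (y - c j) /\<^sub>R inverse (l (snd j))))"
        unfolding linear_diff[OF bounded_linear.linear[OF bounded_linear_l1_single], symmetric]
          norm_l1_single by simp
      also have "\<dots> \<le> dist (x - c j) (y - c j)"
        using l by (intro norm_scaled_dirac_diff_le) simp
      finally show ?thesis by (simp add: dist_norm)
    qed
    \<comment> \<open>\<open>?G\<close> is 1-Lipschitz and vanishes at the center, and the cutoff
      lives within distance 2 of it.\<close>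
    show "norm (?G x) \<le> 2" if "plateau (norm (x - c j)) \<noteq> 0" for x
      using G[of x "c j"] plateau_nonzero[OF that]
      by (simp add: dist_norm linear_0[OF bounded_linear.linear[OF bounded_linear_l1_single]])
  qed (simp_all add: plateau_bounds)
  define rr where "rr z = (\<Sum>j\<in>J z. r j z)" for z
  have rr: "rr (c j + w) = l1_single (fst j) (inverse (l (snd j)) *\<^sub>R dirac (l (snd j) *\<^sub>R w))"
    if "norm w \<le> 1" for j w
  proof -
    have "J (c j + w) = {j}"
      using that c[of "c j + w" j] by (auto simp: J_def)
    then show ?thesis using that by (simp add: rr_def r_def plateau_one)
  qed
  have rr_c: "rr (c j) = 0" for j
    using rr[of 0 j] by (simp add: linear_0[OF bounded_linear.linear[OF bounded_linear_l1_single]])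
  have rr_lip: "norm (rr x - rr y) \<le> (2 * real 1 * (1 + 1 * 2)) * dist x y" for x y
    unfolding rr_def by (rule lipschitz_sum_finite_support[where N = 1, OF r_lip J r_out]) simp_all
  have "J 0 = {}"
    by (auto simp: J_def c_def e)
  then have "rr 0 = 0"
    by (simp add: rr_def)
  then obtain R where R: "bounded_linear R" "\<And>x. R (dirac x) = rr x"
    using ex_linearization_l1_sum[of rr, OF _ rr_lip] by auto

  \<comment> \<open>Subtracting the point mass at the center makes the map vanish at 0, so on the
    annulus its norm is at most \<open>l k\<close>, however far away the center is. \<open>R\<close>
    kills the subtracted term.\<close>
  define s where "s n k x = tent_at k x *\<^sub>R
    (l k *\<^sub>R dirac (c (n, k) + x /\<^sub>R l k) - l k *\<^sub>R dirac (c (n, k)))" for n k x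
  have s_lip: "norm (s n k x - s n k y) \<le> (1 + 2 / 2 powr k * l k) * dist x y" for n k x y
    unfolding s_def
  proof (rule lipschitz_cutoff)
    let ?G = "\<lambda>x. l k *\<^sub>R dirac (c (n, k) + x /\<^sub>R l k) - l k *\<^sub>R dirac (c (n, k))"
    show G: "norm (?G x - ?G y) \<le> dist x y" for x y
      using norm_scaled_dirac_diff_le[OF l] by simp
    show "norm (?G x) \<le> l k" if "tent_at k x \<noteq> 0" for x
      using G[of x 0] tent_nonzero[of "norm x / 2 powr k"] that
      by (simp add: tent_at_def l_def field_simps)
    show "\<bar>tent_at k x\<bar> \<le> 1" for x by (simp add: tent_at_def tent_bounds)
  qed (use l[of k] in \<open>simp_all only: tent_at_lipschitz less_imp_le\<close>, simp)
  \<comment> \<open>The slope \<open>2 / 2 powr k\<close> of the cutoff cancels against the size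
    \<open>l k\<close> of the annulus, leaving 1 + 4 at every scale.\<close>
  have s_lip': "norm (s n k x - s n k y) \<le> 5 * dist x y" for n k x y
    using s_lip[of n k x y] by (simp add: l_def)
  define ss where "ss n x = (\<Sum>k\<in>tent_indices x. s n k x)" for n x
  \<comment> \<open>Two scales at most contribute at each point. The constant does not depend on
    \<open>n\<close>, which is what gluing the operators \<open>Sn n\<close> requires.\<close>
  have ss_lip: "norm (ss n x - ss n y) \<le> (2 * real 2 * 5) * dist x y" for n x y
    unfolding ss_def
    by (rule lipschitz_sum_finite_support[where N = 2, OF s_lip'])
      (auto simp: tent_indices_def s_def tent_at_outside)
  have ss0: "ss n 0 = 0" for n
    by (simp add: ss_def s_def)
  have "\<forall>n. \<exists>S. bounded_linear S \<and> (\<forall>x. S (dirac x) = ss n x) \<and> (\<forall>u. norm (S u) \<le> (2 * real 2 * 5) * norm u)"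
    using ex_linearization[OF ss0 ss_lip] by fastforce
  then obtain Sn where Sn: "\<And>n. bounded_linear (Sn n)" "\<And>n x. Sn n (dirac x) = ss n x"
    "\<And>n u. norm (Sn n u) \<le> (2 * real 2 * 5) * norm u"
    by metis
  obtain S where S: "bounded_linear S" "\<And>y. (\<lambda>n. Sn n (l1_nth y n)) sums S y"
    using ex_l1_sum_operator[of Sn, OF Sn(1,3)] by blast

  note R_lin = bounded_linear.linear[OF R(1)]
  \<comment> \<open>The shrunk point lies in the unit ball around \<open>c (n, k)\<close>, where
    \<open>rr\<close> is the exact inverse dilation, and the weights \<open>l k\<close> and its
    inverse cancel.\<close>
  have Rs: "R (s n k x) = tent_at k x *\<^sub>R l1_single n (dirac x)" for n k x
  proof (cases "tent_at k x = 0")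
    case False
    then have "norm (x /\<^sub>R l k) \<le> 1"
      using tent_nonzero[of "norm x / 2 powr k"] by (simp add: tent_at_def l_def field_simps)
    then have "rr (c (n, k) + x /\<^sub>R l k) = l1_single n (inverse (l k) *\<^sub>R dirac x)"
      using l[of k] by (simp add: rr)
    then show ?thesis
      using l[of k] by (simp add: s_def linear_cmul[OF R_lin] linear_diff[OF R_lin] R rr_c
        linear_cmul[OF bounded_linear.linear[OF bounded_linear_l1_single]])
  qed (simp add: s_def linear_0[OF R_lin])
  have "R (Sn n (dirac x)) = l1_single n (dirac x)" for n x
  proof (cases "x = 0")
    case True
    then show ?thesis
      by (simp add: linear_0[OF bounded_linear.linear[OF bounded_linear_l1_single]]
        linear_0[OF bounded_linear.linear[OF Sn(1)]] linear_0[OF R_lin])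
  next
    case False
    then show ?thesis
      by (simp add: Sn ss_def linear_sum[OF R_lin] Rs sum_tent_at flip: scaleR_sum_left)
  qed
  then have RSn: "R (Sn n u) = l1_single n u" for n u
    by (rule bounded_linear_eq_on_dirac[OF bounded_linear_compose[OF R(1) Sn(1)] bounded_linear_l1_single])
  \<comment> \<open>Continuity of \<open>R\<close> along the series for \<open>S y\<close> reduces
    the identity to the single summands.\<close>
  have "R (S y) = y" for y
    using bounded_linear.sums[OF R(1) S(2)[of y]]
    by (intro sums_unique2[OF _ sums_l1_single[of y]]) (simp add: RSn)
  with R(1) S(1) show ?thesis by blast
qed

theorem theorem3p1:
  shows "\<exists>T :: 'a::banach lipschitz_free \<Rightarrow> 'a lipschitz_free l1_sum.
    bounded_linear T \<and> bij T \<and> bounded_linear (inv T)"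
proof (cases "\<exists>x :: 'a. x \<noteq> 0")
  case True
  then obtain x :: 'a where "x \<noteq> 0" by blast
  then have "norm (sgn x) = 1" by (simp add: norm_sgn)
  from ex_section[OF this] show ?thesis
    using pelczynski_decomposition by blast
next
  \<comment> \<open>Without a nonzero vector there is no ray for the centers; but then the free
    space and its sum are both zero, and zero maps serve as \<open>R\<close> and
    \<open>S\<close>.\<close>
  case False
  then have "dirac x = 0" for x :: 'a
    using dirac_zero by metis
  then have "u = 0" for u :: "'a lipschitz_free"
    using bounded_linear_eq_on_dirac[OF bounded_linear_ident bounded_linear_zero] by blast
  then have "y = 0" for y :: "'a lipschitz_free l1_sum"
    by (intro l1_sum_eqI) metis
  then show ?thesis
    using pelczynski_decomposition[OF bounded_linear_zero bounded_linear_zero,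
      where ?'b = "'a lipschitz_free"] by (metis (full_types))
qed

end
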